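(* Let $A=(a_1,\dots,a_k)$ be a real-valued pinwheel instance whose periods take exactly two distinct values (each value may occur any number of times), and suppose $D(A)=\sum_{i=1}^k \frac{1}{a_i}\le \frac{5}{6}$. Then $A$ is schedulable.
   Context: A real-valued pinwheel instance is a finite sequence $A=(a_1,\dots,a_k)$ of real numbers $a_i\ge 1$; $a_i$ is the period of task $i$. A schedule is a map $S:\mathbb{Z}\to\{1,\dots,k\}$. $S$ is valid for $A$ if for every task $i$, every positive integer $l$ and every $m\in\mathbb{Z}$, there are at least $l$ integers $t$ with $m\le t< m+\lceil l a_i\rceil$ and $S(t)=i$. $A$ is schedulable if some schedule is valid for it. The density of $A$ is $D(A)=\sum_{i=1}^k 1/a_i$. *)

theory Defs
  imports Complex_Main
begin

(* An instance is the list of its periods; the tasks are the positions 0, ..., length A - 1. *)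
definition pinwheel_instance :: "real list \<Rightarrow> bool" where
  "pinwheel_instance A \<longleftrightarrow> (\<forall>a\<in>set A. 1 \<le> a)"

definition density :: "real list \<Rightarrow> real" where
  "density A = (\<Sum>a\<leftarrow>A. 1 / a)"

definition schedule :: "real list \<Rightarrow> (int \<Rightarrow> nat) \<Rightarrow> bool" where
  "schedule A S \<longleftrightarrow> (\<forall>t. S t < length A)"

definition valid_for :: "real list \<Rightarrow> (int \<Rightarrow> nat) \<Rightarrow> bool" where
  "valid_for A S \<longleftrightarrow>
     (\<forall>i<length A. \<forall>l::nat. l > 0 \<longrightarrow>
       (\<forall>m::int. l \<le> card {t::int. m \<le> t \<and> t < m + \<lceil>real l * A ! i\<rceil> \<and> S t = i}))"

definition schedulable :: "real list \<Rightarrow> bool" where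
  "schedulable A \<longleftrightarrow> (\<exists>S. schedule A S \<and> valid_for A S)"

end

(*
  Let p tasks have period a and q tasks have period b, and put \<beta> = q / b. Give the b-tasks the slots
  t at which the staircase \<lfloor>\<beta> t\<rfloor> jumps and the a-tasks all other slots, both in round-robin order.
  A window of length L = \<lceil>l b\<rceil> contains at least \<lfloor>\<beta> L\<rfloor> \<ge> l q slots of the first kind. A window of
  length L = \<lceil>l a\<rceil> contains at least L - \<lceil>\<beta> L\<rceil> = \<lfloor>(1 - \<beta>) L\<rfloor> slots of the second kind, which is at
  least l p because 1 - \<beta> \<ge> p / a.
*)
theory Submission
  imports Defs
begin

text \<open>A discrete intermediate value argument: steps of height at most one skip no value, so a
  window that starts at or below \<open>v\<close> and ends above it contains the slot at which
  \<open>F\<close> leaves \<open>v\<close>.\<close>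

lemma staircase_attains:
  fixes F :: "int \<Rightarrow> int"
  assumes step: "\<And>t. F (t + 1) = F t \<or> F (t + 1) = F t + 1"
    and "F m \<le> v" "v < F (m + int L)"
  shows "\<exists>t. m \<le> t \<and> t < m + int L \<and> F t = v \<and> F (t + 1) = v + 1"
  using assms(3)
proof (induction L)
  case 0
  then show ?case using assms(2) by simp
next
  case (Suc L)
  show ?case
  proof (cases "v < F (m + int L)")
    case True
    then show ?thesis using Suc.IH by force
  next
    case False
    then have "F (m + int L) = v \<and> F (m + int L + 1) = v + 1"
      using Suc.prems step[of "m + int L"] by (auto simp: algebra_simps)
    then show ?thesis by (intro exI[of _ "m + int L"]) simp
  qed
qed

text \<open>The value of \<open>F\<close> before a jump numbers that jump, so the residue
  \<open>r\<close> marks the turns of one task in a round robin of \<open>n\<close>. A rise by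
  \<open>l * n\<close> runs through at least \<open>l * n\<close> consecutive values, and each
  residue class contains at least \<open>l\<close> of them.\<close>

lemma staircase_residue_card:
  fixes F :: "int \<Rightarrow> int" and l n r :: nat
  assumes step: "\<And>t. F (t + 1) = F t \<or> F (t + 1) = F t + 1"
    and "r < n"
    and rise: "F m + int (l * n) \<le> F (m + L)"
    and "0 \<le> L"
  shows "l \<le> card {t. m \<le> t \<and> t < m + L \<and> F (t + 1) = F t + 1 \<and> F t mod int n = int r}"
    (is "l \<le> card ?T")
proof -
  \<comment> \<open>\<open>v 0\<close>, \<open>v 1\<close>, ... are the values from
    \<open>F m\<close> upwards that are congruent to \<open>r\<close>. The initial offset is at most
    \<open>n - 1\<close>, so the first \<open>l\<close> of them stay below
    \<open>F m + l * n\<close>.\<close>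
  define v where "v j = F m + (int r - F m) mod int n + int j * int n" for j :: nat
  have n: "0 < int n" using \<open>r < n\<close> by simp
  have v_mod: "v j mod int n = int r" for j
    using \<open>r < n\<close> by (simp add: v_def mod_simps)
  have attained: "v j \<in> F ` ?T" if "j < l" for j
  proof -
    have "(int r - F m) mod int n < int n" using n by simp
    moreover have "int (Suc j) * int n \<le> int l * int n"
      using that by (intro mult_right_mono) auto
    ultimately have "v j < F (m + int (nat L))"
      using rise \<open>0 \<le> L\<close> by (simp add: v_def algebra_simps)
    moreover have "F m \<le> v j" using n by (simp add: v_def)
    ultimately obtain t where "m \<le> t" "t < m + L" "F t = v j" "F (t + 1) = v j + 1"
      using staircase_attains[of F, OF step] \<open>0 \<le> L\<close> by fastforce
    then show ?thesis using v_mod[of j] by (intro image_eqI[of _ _ t]) auto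
  qed
  have fin: "finite ?T"
    by (rule finite_subset[of _ "{m..<m + L}"]) auto
  \<comment> \<open>Distinct values of \<open>F\<close> come from distinct slots, so it is enough to
    count values.\<close>
  have "inj_on v {..<l}" using n by (auto simp: inj_on_def v_def)
  then have "l = card (v ` {..<l})" by (simp add: card_image)
  also have "\<dots> \<le> card (F ` ?T)"
    using attained fin by (intro card_mono) auto
  also have "\<dots> \<le> card ?T" using fin by (rule card_image_le)
  finally show ?thesis .
qed

lemma density_two_periods:
  assumes "set A = {a, b}" "a \<noteq> b"
  shows "density A = card {i. i < length A \<and> A ! i = a} / a
    + card {i. i < length A \<and> A ! i = b} / b"
    (is "_ = card ?P / a + card ?Q / b")
proof -
  have "density A = (\<Sum>i<length A. 1 / A ! i)"
    by (simp add: density_def sum_list_sum_nth atLeast0LessThan)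
  also have "{..<length A} = ?P \<union> ?Q"
    using nth_mem[of _ A] assms(1) by auto
  also have "(\<Sum>i\<in>\<dots>. 1 / A ! i) = (\<Sum>i\<in>?P. 1 / A ! i) + (\<Sum>i\<in>?Q. 1 / A ! i)"
    using assms(2) by (intro sum.union_disjoint) auto
  finally show ?thesis by simp
qed

lemma schedulable_two_periods:
  assumes inst: "pinwheel_instance A"
    and set_A: "set A = {a, b}"
    and "a \<noteq> b"
    and dens: "density A \<le> 1"
  shows "schedulable A"
proof -
  define P where "P = {i. i < length A \<and> A ! i = a}"
  define Q where "Q = {i. i < length A \<and> A ! i = b}"
  define p where "p = card P"
  define q where "q = card Q"
  define \<beta> where "\<beta> = real q / b"
  have fin: "finite P" "finite Q" by (auto simp: P_def Q_def)
  have pos: "0 < a" "0 < b" using inst set_A by (auto simp: pinwheel_instance_def)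
  have "P \<noteq> {}" "Q \<noteq> {}"
    using set_A in_set_conv_nth[of a A] in_set_conv_nth[of b A] by (auto simp: P_def Q_def)
  then have pq: "0 < p" "0 < q" using fin by (auto simp: p_def q_def card_gt_0_iff)
  have dens': "p / a + \<beta> \<le> 1"
    using dens density_two_periods[OF set_A \<open>a \<noteq> b\<close>]
    by (simp add: p_def q_def \<beta>_def P_def Q_def)
  have "0 \<le> p / a" using pos by simp
  then have \<beta>: "0 \<le> \<beta>" "\<beta> \<le> 1"
    using dens' pos by (simp add: \<beta>_def, linarith)
  obtain f where f: "bij_betw f {0..<p} P"
    using ex_bij_betw_nat_finite[OF fin(1)] by (auto simp: p_def)
  obtain g where g: "bij_betw g {0..<q} Q"
    using ex_bij_betw_nat_finite[OF fin(2)] by (auto simp: q_def)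

  define H where "H t = \<lfloor>\<beta> * of_int t\<rfloor>" for t :: int
  define G where "G t = t - H t" for t
  \<comment> \<open>As \<open>H t + G t = t\<close>, exactly one of the two staircases jumps at each
    slot, and its current value selects whose turn it is.\<close>
  define S where "S t = (if H (t + 1) = H t + 1 then g (nat (H t mod int q))
    else f (nat (G t mod int p)))" for t
  have H_step: "H (t + 1) = H t \<or> H (t + 1) = H t + 1" for t
    using \<beta> unfolding H_def by (simp add: distrib_left) linarith
  have G_step: "G (t + 1) = G t \<or> G (t + 1) = G t + 1" for t
    using H_step[of t] by (auto simp: G_def)

  have "S t < length A" for t
  proof -
    \<comment> \<open>The staircases may be negative for negative \<open>t\<close>, but residues
      modulo a positive number are not, so \<open>nat\<close> loses nothing.\<close>
    have "nat (H t mod int q) \<in> {0..<q}" "nat (G t mod int p) \<in> {0..<p}"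
      using pq by (auto simp: nat_less_iff)
    then have "S t \<in> P \<union> Q"
      using bij_betwE[OF f] bij_betwE[OF g] by (auto simp: S_def)
    then show ?thesis by (auto simp: P_def Q_def)
  qed
  moreover have "l \<le> card {t. m \<le> t \<and> t < m + \<lceil>real l * A ! i\<rceil> \<and> S t = i}"
    (is "_ \<le> card ?W") if i: "i < length A" for i l m
  proof -
    define L where "L = \<lceil>real l * A ! i\<rceil>"
    have fin_W: "finite ?W"
      by (rule finite_subset[of _ "{m..<m + L}"]) (auto simp: L_def)
    have Ai: "A ! i = a \<or> A ! i = b" using set_A i nth_mem by blast
    have L: "real l * A ! i \<le> of_int L" by (simp add: L_def)
    have "0 \<le> real l * A ! i" using Ai pos by auto
    then have L0: "0 \<le> L" using L by linarith
    show ?thesis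
    proof (cases "A ! i = b")
      case True
      then have "i \<in> Q" using i by (simp add: Q_def)
      then obtain r where r: "r < q" "g r = i"
        using g by (auto simp: bij_betw_def)
      have "real (l * q) = \<beta> * (real l * b)" using pos by (simp add: \<beta>_def)
      also have "\<dots> \<le> \<beta> * of_int L" using L True \<beta> by (intro mult_left_mono) auto
      \<comment> \<open>Adding at least the integer \<open>l * q\<close> to
        \<open>\<beta> * m\<close> raises its floor by at least as much, wherever the window
        starts.\<close>
      finally have "H m + int (l * q) \<le> H (m + L)"
        unfolding H_def by (simp add: distrib_left le_floor_iff) linarith
      from staircase_residue_card[of H, OF H_step r(1) this L0]
      have "l \<le> card {t. m \<le> t \<and> t < m + L \<and> H (t + 1) = H t + 1 \<and> H t mod int q = int r}" .
      also have "\<dots> \<le> card ?W"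
        using fin_W by (rule card_mono) (auto simp: L_def S_def r)
      finally show ?thesis .
    next
      case False
      then have Aa: "A ! i = a" using Ai by simp
      then have "i \<in> P" using i by (simp add: P_def)
      then obtain r where r: "r < p" "f r = i"
        using f by (auto simp: bij_betw_def)
      have "real (l * p) = p / a * (real l * a)" using pos by simp
      also have "\<dots> \<le> (1 - \<beta>) * of_int L"
        using L Aa dens' pos \<beta> by (intro mult_mono) auto
      \<comment> \<open>This bound is an integer because \<open>L\<close> is already rounded up, so
        it passes through the floor without an extra unit.\<close>
      finally have "\<beta> * of_int L \<le> of_int (L - int (l * p))"
        by (simp add: algebra_simps)
      then have "H (m + L) \<le> H m + (L - int (l * p))"
        unfolding H_def by (simp add: distrib_left floor_le_iff) linarith
      then have "G m + int (l * p) \<le> G (m + L)" by (simp add: G_def)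
      from staircase_residue_card[of G, OF G_step r(1) this L0]
      have "l \<le> card {t. m \<le> t \<and> t < m + L \<and> G (t + 1) = G t + 1 \<and> G t mod int p = int r}" .
      \<comment> \<open>A jump of \<open>G\<close> at \<open>t\<close> means that \<open>H\<close>
        stays put there, so \<open>S\<close> takes its second branch.\<close>
      also have "\<dots> \<le> card ?W"
        using fin_W by (rule card_mono) (auto simp: L_def S_def G_def r)
      finally show ?thesis .
    qed
  qed
  ultimately show ?thesis
    unfolding schedulable_def schedule_def valid_for_def by blast
qed

theorem theorem6:
  fixes A :: "real list"
  assumes "pinwheel_instance A"
    and "card (set A) = 2"
    and "density A \<le> 5 / 6"
  shows "schedulable A"
proof -
  obtain a b where "set A = {a, b}" "a \<noteq> b"
    using assms(2) by (auto simp: card_2_iff)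
  then show ?thesis
    using schedulable_two_periods assms by force
qed

end
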